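(* Let $(X,d)$ be a metric space and let $\emptyset\neq A\subseteq X$. Then the following statements are equivalent: (a) $A$ is a UC set. (b) Whenever $f:(X,d)\to\mathbb{R}$ is a continuous and never zero function such that $f$ is strongly uniformly continuous on $A$, then $\frac{1}{f}$ is also strongly uniformly continuous on $A$.
   Context: For $x\in X$, $I(x)=d(x,X\setminus\{x\})=\inf\{d(x,y):y\in X,\ y\neq x\}$. A subset $A$ of $(X,d)$ is called a UC set if every sequence $(a_n)$ in $A$ with $\lim_{n\to\infty}I(a_n)=0$ has a cluster point in $X$. A function $f:(X,d)\to(Y,\rho)$ between metric spaces is strongly uniformly continuous on $B\subseteq X$ if for every $\epsilon>0$ there exists $\delta>0$ such that if $x,y\in X$, $d(x,y)<\delta$ and $\{x,y\}\cap B\neq\emptyset$, then $\rho(f(x),f(y))<\epsilon$. $\mathbb{R}$ carries its usual metric. *)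

theory Defs
  imports "HOL-Analysis.Analysis"
begin

text \<open>The ambient metric space is the type \<open>'a::metric_space\<close>.\<close>

text \<open>The infimum is taken in \<^typ>\<open>ereal\<close>, so it is \<open>\<infinity>\<close> when the space is a singleton
  (\<open>infdist x (UNIV - {x})\<close> would be 0 there).\<close>

definition isolation :: "'a::metric_space \<Rightarrow> ereal" where
  "isolation x = (INF y\<in>UNIV - {x}. ereal (dist x y))"

definition seq_cluster_point :: "(nat \<Rightarrow> 'a::topological_space) \<Rightarrow> 'a \<Rightarrow> bool" where
  "seq_cluster_point a x \<longleftrightarrow>
     (\<forall>U. open U \<and> x \<in> U \<longrightarrow> (\<exists>\<^sub>F n in sequentially. a n \<in> U))"

definition UC_set :: "'a::metric_space set \<Rightarrow> bool" where
  "UC_set A \<longleftrightarrow>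
     (\<forall>a :: nat \<Rightarrow> 'a. range a \<subseteq> A \<and> (\<lambda>n. isolation (a n)) \<longlonglongrightarrow> 0
        \<longrightarrow> (\<exists>x. seq_cluster_point a x))"

text \<open>The points range over the whole space; only one of them needs to lie in \<open>B\<close>.\<close>

definition strongly_uniformly_continuous_on ::
    "'a::metric_space set \<Rightarrow> ('a \<Rightarrow> 'b::metric_space) \<Rightarrow> bool" where
  "strongly_uniformly_continuous_on B f \<longleftrightarrow>
     (\<forall>\<epsilon>>0. \<exists>\<delta>>0. \<forall>x y. dist x y < \<delta> \<and> {x, y} \<inter> B \<noteq> {} \<longrightarrow> dist (f x) (f y) < \<epsilon>)"

end

theory Submission
  imports Defs
begin

text \<open>
  If \<open>A\<close> is a UC set, then every continuous function on the space, and in particular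
  \<open>1 / f\<close>, is strongly uniformly continuous on \<open>A\<close>
  (\<open>UC_set_imp_strongly_uniformly_continuous_on\<close>): points \<open>x n \<in> A\<close> and \<open>y n\<close> that get
  arbitrarily close while their images stay apart are distinct, so the isolation of \<open>x n\<close>
  tends to 0; around a cluster point of \<open>x\<close> this contradicts continuity.

  Conversely, let \<open>a\<close> be a sequence in \<open>A\<close> whose isolation tends to 0 but which has no cluster
  point. Along a subsequence there are points \<open>b n \<noteq> a n\<close> with \<open>dist (a n) (b n) \<longlonglongrightarrow> 0\<close>. The absence of cluster
  points allows passing to a further subsequence for which no \<open>b n\<close> is any \<open>a m\<close>
  (\<open>ex_subseq_disjoint\<close>), and then each \<open>b n\<close> has a positive distance \<open>t n\<close> to the whole set of
  the \<open>a m\<close>. The function \<open>f x = inf\<^sub>m (c m + dist x (a m))\<close> with constants \<open>c m > 0\<close> is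
  1-Lipschitz and is positive, again because \<open>a\<close> has no cluster points. It satisfies
  \<open>f (a n) \<le> c n\<close> and \<open>f (b n) \<ge> t n\<close>; so if \<open>c n\<close> is chosen with \<open>1 / c n = 1 / t n + 1\<close>, the
  values of \<open>1 / f\<close> at \<open>a n\<close> and \<open>b n\<close> differ by at least 1 (\<open>ex_lipschitz_reciprocal_gap\<close>). Hence
  \<open>1 / f\<close> is not strongly uniformly continuous on \<open>A\<close>.
\<close>

section \<open>Strong uniform continuity, isolation and cluster points\<close>

lemma strongly_uniformly_continuous_on_tendsto:
  assumes suc: "strongly_uniformly_continuous_on A f"
    and xA: "range x \<subseteq> A" and lim: "(\<lambda>n. dist (x n) (y n)) \<longlonglongrightarrow> 0"
  shows "(\<lambda>n. dist (f (x n)) (f (y n))) \<longlonglongrightarrow> 0"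
proof (rule tendstoI)
  fix e :: real assume "e > 0"
  then obtain d where "d > 0"
    and d: "\<And>u v. dist u v < d \<Longrightarrow> {u, v} \<inter> A \<noteq> {} \<Longrightarrow> dist (f u) (f v) < e"
    using suc unfolding strongly_uniformly_continuous_on_def by meson
  have "\<forall>\<^sub>F n in sequentially. dist (x n) (y n) < d"
    using lim \<open>d > 0\<close> by (rule order_tendstoD)
  then show "\<forall>\<^sub>F n in sequentially. dist (dist (f (x n)) (f (y n))) 0 < e"
    by (rule eventually_mono) (use d xA in \<open>simp add: image_subset_iff\<close>)
qed

lemma uniformly_continuous_imp_strongly_uniformly_continuous_on:
  "uniformly_continuous_on UNIV f \<Longrightarrow> strongly_uniformly_continuous_on A f"
  unfolding uniformly_continuous_on_def strongly_uniformly_continuous_on_def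
  by (metis UNIV_I dist_commute)

lemma dist_tendsto_0_if_less_inverse:
  assumes "\<And>n. dist (x n) (y n) < inverse (real (Suc n))"
  shows "(\<lambda>n. dist (x n) (y n)) \<longlonglongrightarrow> 0"
  by (rule tendsto_sandwich[OF _ _ tendsto_const LIMSEQ_inverse_real_of_nat])
    (use assms in \<open>simp_all only: less_imp_le zero_le_dist eventually_True\<close>)

lemma isolation_less_iff: "isolation x < ereal e \<longleftrightarrow> (\<exists>y. y \<noteq> x \<and> dist x y < e)"
  unfolding isolation_def by (auto simp: INF_less_iff)

lemma isolation_tendsto_0:
  assumes "(\<lambda>n. dist (a n) (b n)) \<longlonglongrightarrow> 0" and "\<And>n. b n \<noteq> a n"
  shows "(\<lambda>n. isolation (a n)) \<longlonglongrightarrow> 0"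
proof (rule tendsto_sandwich[OF _ _ tendsto_const])
  show "\<forall>\<^sub>F n in sequentially. 0 \<le> isolation (a n)"
    by (simp add: isolation_def le_INF_iff)
  show "\<forall>\<^sub>F n in sequentially. isolation (a n) \<le> ereal (dist (a n) (b n))"
    unfolding isolation_def using assms(2) by (intro always_eventually allI INF_lower) auto
  show "(\<lambda>n. ereal (dist (a n) (b n))) \<longlonglongrightarrow> 0"
    using assms(1) by (simp add: zero_ereal_def)
qed

lemma seq_cluster_point_iff_dist:
  fixes x :: "'a::metric_space"
  shows "seq_cluster_point a x \<longleftrightarrow> (\<forall>e>0. \<exists>\<^sub>F n in sequentially. dist x (a n) < e)"
  unfolding seq_cluster_point_def
proof (intro iffI allI impI; (elim conjE)?)
  fix e :: real
  assume "\<forall>U. open U \<and> x \<in> U \<longrightarrow> (\<exists>\<^sub>F n in sequentially. a n \<in> U)" "e > 0"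
  then have "\<exists>\<^sub>F n in sequentially. a n \<in> ball x e"
    by (meson centre_in_ball open_ball)
  then show "\<exists>\<^sub>F n in sequentially. dist x (a n) < e" by simp
next
  fix U assume *: "\<forall>e>0. \<exists>\<^sub>F n in sequentially. dist x (a n) < e" and "open U" "x \<in> U"
  then obtain e where "e > 0" "ball x e \<subseteq> U" by (meson open_contains_ball)
  then show "\<exists>\<^sub>F n in sequentially. a n \<in> U"
    using * by (meson frequently_elim1 mem_ball subsetD)
qed

section \<open>Continuous functions over a UC set\<close>

lemma UC_set_imp_strongly_uniformly_continuous_on:
  assumes "UC_set A" and "continuous_on UNIV g"
  shows "strongly_uniformly_continuous_on A g"
proof (rule ccontr)
  assume "\<not> strongly_uniformly_continuous_on A g"
  then obtain e where "e > 0"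
    and e: "\<And>d. d > 0 \<Longrightarrow> \<exists>u v. dist u v < d \<and> {u, v} \<inter> A \<noteq> {} \<and> e \<le> dist (g u) (g v)"
    unfolding strongly_uniformly_continuous_on_def by (meson not_le)
  have "\<exists>u v. u \<in> A \<and> dist u v < inverse (real (Suc n)) \<and> e \<le> dist (g u) (g v)" for n
  proof -
    obtain u v where "dist u v < inverse (real (Suc n))" "u \<in> A \<or> v \<in> A" "e \<le> dist (g u) (g v)"
      using e[of "inverse (real (Suc n))"] by auto
    then show ?thesis by (metis dist_commute)
  qed
  then obtain x y where xA: "\<And>n. x n \<in> A"
    and xy: "\<And>n. dist (x n) (y n) < inverse (real (Suc n))"
    and gxy: "\<And>n. e \<le> dist (g (x n)) (g (y n))"
    by metis
  have lim: "(\<lambda>n. dist (x n) (y n)) \<longlonglongrightarrow> 0"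
    using xy by (rule dist_tendsto_0_if_less_inverse)
  moreover have "y n \<noteq> x n" for n
    using gxy[of n] \<open>e > 0\<close> by auto
  ultimately have "(\<lambda>n. isolation (x n)) \<longlonglongrightarrow> 0" by (rule isolation_tendsto_0)
  then obtain z where z: "seq_cluster_point x z"
    using \<open>UC_set A\<close> xA unfolding UC_set_def by blast
  obtain d where "d > 0" and d: "\<And>u. dist u z < d \<Longrightarrow> dist (g u) (g z) < e / 2"
    using \<open>continuous_on UNIV g\<close> \<open>e > 0\<close> unfolding continuous_on_iff
    by (metis UNIV_I half_gt_zero)
  have "\<exists>\<^sub>F n in sequentially. dist z (x n) < d / 2"
    using z[unfolded seq_cluster_point_iff_dist, rule_format, of "d / 2"] \<open>d > 0\<close> by simp
  moreover have "\<forall>\<^sub>F n in sequentially. dist (x n) (y n) < d / 2"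
    using order_tendstoD(2)[OF lim, of "d / 2"] \<open>d > 0\<close> by simp
  ultimately obtain n where n: "dist z (x n) < d / 2" "dist (x n) (y n) < d / 2"
    by (metis (mono_tags, lifting) eventually_mono frequently_def)
  then have "dist (x n) z < d" "dist (y n) z < d"
    using dist_triangle[of "y n" z "x n"] \<open>d > 0\<close> by (auto simp: dist_commute)
  then have "dist (g (x n)) (g (y n)) < e"
    using d dist_triangle_half_l by blast
  then show False using gxy[of n] by simp
qed

section \<open>Sequences without cluster points\<close>

lemma not_cluster_iff_eventually_bounded_away:
  fixes a :: "nat \<Rightarrow> 'a::metric_space"
  shows "(\<nexists>x. seq_cluster_point a x) \<longleftrightarrow> (\<forall>x. \<exists>e>0. \<forall>\<^sub>F n in sequentially. e \<le> dist x (a n))"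
  by (simp add: seq_cluster_point_iff_dist not_frequently not_less)

lemma not_cluster_reindex:
  fixes a :: "nat \<Rightarrow> 'a::metric_space"
  assumes "\<nexists>x. seq_cluster_point a x" and "filterlim r sequentially sequentially"
  shows "\<nexists>x. seq_cluster_point (\<lambda>n. a (r n)) x"
  unfolding not_cluster_iff_eventually_bounded_away
proof
  fix x
  obtain e where "e > 0" and e: "\<forall>\<^sub>F n in sequentially. e \<le> dist x (a n)"
    using assms(1) unfolding not_cluster_iff_eventually_bounded_away by blast
  from e have "\<forall>\<^sub>F n in sequentially. e \<le> dist x (a (r n))"
    using assms(2) by (rule eventually_compose_filterlim)
  with \<open>e > 0\<close> show "\<exists>e>0. \<forall>\<^sub>F n in sequentially. e \<le> dist x (a (r n))" by blast
qed

lemma positive_sequence_bounded_away: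
  fixes u :: "nat \<Rightarrow> real"
  assumes "\<And>n. u n > 0" and "e > 0" and "\<forall>\<^sub>F n in sequentially. e \<le> u n"
  shows "\<exists>d>0. \<forall>n. d \<le> u n"
proof -
  obtain N where N: "\<And>n. n \<ge> N \<Longrightarrow> e \<le> u n"
    using assms(3) by (auto simp: eventually_sequentially)
  let ?d = "Min (insert e (u ` {..<N}))"
  have "?d \<le> u n" for n
  proof (cases "n < N")
    case True
    then show ?thesis by (intro Min_le) auto
  next
    case False
    then have "e \<le> u n" using N by simp
    moreover have "?d \<le> e" by (intro Min_le) auto
    ultimately show ?thesis by linarith
  qed
  moreover have "?d > 0" using assms(1,2) by (subst Min_gr_iff) auto
  ultimately show ?thesis by blast
qed

section \<open>Infima of cones over a sequence\<close>

text \<open>The distance functions to the \<open>a m\<close>, raised by \<open>c m\<close>, are 1-Lipschitz, and this passes to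
  their infimum.\<close>

lemma lipschitz_on_INF_dist:
  fixes a :: "nat \<Rightarrow> 'a::metric_space" and c :: "nat \<Rightarrow> real"
  assumes "\<And>m. c m \<ge> 0"
  shows "1-lipschitz_on UNIV (\<lambda>x. INF m. c m + dist x (a m))"
proof (rule lipschitz_onI)
  have bdd: "bdd_below (range (\<lambda>m. c m + dist x (a m)))" for x
    using assms by (intro bdd_belowI2[where m = 0]) simp
  have le: "(INF m. c m + dist x (a m)) - dist x y \<le> (INF m. c m + dist y (a m))" for x y
  proof (rule cINF_greatest)
    fix m
    have "(INF m. c m + dist x (a m)) \<le> c m + dist x (a m)"
      by (rule cINF_lower[OF bdd]) simp
    then show "(INF m. c m + dist x (a m)) - dist x y \<le> c m + dist y (a m)"
      using dist_triangle[of x "a m" y] by linarith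
  qed simp
  show "dist (INF m. c m + dist x (a m)) (INF m. c m + dist y (a m)) \<le> 1 * dist x y" for x y
    using le[of x y] le[of y x] by (simp add: dist_real_def abs_le_iff dist_commute[of y x])
qed simp

text \<open>The infimum of the cones over the \<open>a m\<close> is at most the tip height \<open>c n\<close> at \<open>a n\<close>, but at
  \<open>b n\<close> it is at least the distance of \<open>b n\<close> to the set of the \<open>a m\<close>, whatever the heights. So
  the heights can be fixed after these distances.\<close>

lemma ex_lipschitz_reciprocal_gap:
  fixes a b :: "nat \<Rightarrow> 'a::metric_space"
  assumes no_cluster: "\<nexists>x. seq_cluster_point a x" and disjoint: "\<And>m n. a m \<noteq> b n"
  shows "\<exists>f :: 'a \<Rightarrow> real. 1-lipschitz_on UNIV f \<and> (\<forall>x. f x > 0) \<and>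
           (\<forall>n. 1 / f (b n) + 1 \<le> 1 / f (a n))"
proof -
  have away: "\<exists>e>0. \<forall>\<^sub>F m in sequentially. e \<le> dist x (a m)" for x
    using no_cluster unfolding not_cluster_iff_eventually_bounded_away by blast
  have "\<exists>t>0. \<forall>m. t \<le> dist (b n) (a m)" for n
  proof -
    obtain e where "e > 0" "\<forall>\<^sub>F m in sequentially. e \<le> dist (b n) (a m)"
      using away by blast
    moreover have "dist (b n) (a m) > 0" for m
      using disjoint[of m n] by (metis zero_less_dist_iff)
    ultimately show ?thesis by (intro positive_sequence_bounded_away)
  qed
  then obtain t where t_pos: "\<And>n. t n > 0" and t: "\<And>n m. t n \<le> dist (b n) (a m)"
    by metis
  \<comment> \<open>the solution of \<open>1 / c n = 1 / t n + 1\<close>\<close>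
  define c where "c n = t n / (1 + t n)" for n
  have c_pos: "c n > 0" for n
    using t_pos[of n] by (simp add: c_def)
  define f where "f x = (INF m. c m + dist x (a m))" for x
  have f_lower: "f x \<le> c m + dist x (a m)" for x m
    unfolding f_def using c_pos
    by (intro cINF_lower bdd_belowI2[where m = 0]) (simp_all add: add_nonneg_nonneg less_imp_le)
  have f_greatest: "d \<le> f x" if "\<And>m. d \<le> c m + dist x (a m)" for d x
    unfolding f_def using that by (intro cINF_greatest) auto
  have "1-lipschitz_on UNIV f"
    unfolding f_def using c_pos by (intro lipschitz_on_INF_dist less_imp_le)
  moreover have f_pos: "f x > 0" for x
  proof -
    obtain e where "e > 0" and e: "\<forall>\<^sub>F m in sequentially. e \<le> dist x (a m)"
      using away by blast
    have "\<forall>\<^sub>F m in sequentially. e \<le> c m + dist x (a m)"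
      using e by (rule eventually_mono) (use c_pos in \<open>auto intro: add_increasing less_imp_le\<close>)
    then obtain d where "d > 0" "\<And>m. d \<le> c m + dist x (a m)"
      using positive_sequence_bounded_away[of "\<lambda>m. c m + dist x (a m)" e] \<open>e > 0\<close> c_pos
      by (metis add_pos_nonneg zero_le_dist)
    then show ?thesis using f_greatest by (meson less_le_trans)
  qed
  moreover have "1 / f (b n) + 1 \<le> 1 / f (a n)" for n
  proof -
    have "t n \<le> f (b n)"
      by (rule f_greatest) (metis add_increasing c_pos less_imp_le t)
    then have "1 / f (b n) + 1 \<le> 1 / t n + 1"
      using t_pos[of n] by (simp add: frac_le)
    also have "\<dots> = 1 / c n"
      using t_pos[of n] by (simp add: c_def field_simps)
    also have "\<dots> \<le> 1 / f (a n)"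
      using f_lower[of "a n" n] f_pos[of "a n"] by (simp add: frac_le)
    finally show ?thesis .
  qed
  ultimately show ?thesis by blast
qed

section \<open>Close pairs witnessing the failure of the UC property\<close>

text \<open>Each point is avoided by \<open>a n\<close> and, since \<open>b n\<close> is close to \<open>a n\<close>, by \<open>b n\<close> for all large
  \<open>n\<close>. So a sufficiently sparse subsequence avoids all coincidences between an \<open>a m\<close> and a
  \<open>b n\<close>.\<close>

lemma ex_subseq_disjoint:
  fixes a b :: "nat \<Rightarrow> 'a::metric_space"
  assumes no_cluster: "\<nexists>x. seq_cluster_point a x"
    and lim: "(\<lambda>n. dist (a n) (b n)) \<longlonglongrightarrow> 0" and neq: "\<And>n. b n \<noteq> a n"
  shows "\<exists>r :: nat \<Rightarrow> nat. strict_mono r \<and> (\<forall>m n. a (r m) \<noteq> b (r n))"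
proof -
  have avoid: "\<forall>\<^sub>F n in sequentially. a n \<noteq> x \<and> b n \<noteq> x" for x
  proof -
    obtain e where "e > 0" and e: "\<forall>\<^sub>F n in sequentially. e \<le> dist x (a n)"
      using no_cluster unfolding not_cluster_iff_eventually_bounded_away by blast
    have "\<forall>\<^sub>F n in sequentially. dist (a n) (b n) < e"
      using lim \<open>e > 0\<close> by (rule order_tendstoD)
    with e show ?thesis
      by eventually_elim (use \<open>e > 0\<close> in \<open>auto simp: dist_commute\<close>)
  qed
  have "\<exists>M>N. \<forall>i\<le>N. \<forall>n\<ge>M. a n \<noteq> b i \<and> b n \<noteq> a i" for N
  proof -
    have "\<forall>\<^sub>F n in sequentially. \<forall>i\<in>{..N}. a n \<noteq> b i \<and> b n \<noteq> a i"
      by (intro eventually_ball_finite ballI eventually_conj)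
        (auto intro: eventually_mono[OF avoid])
    then obtain M where "\<And>n i. n \<ge> M \<Longrightarrow> i \<le> N \<Longrightarrow> a n \<noteq> b i \<and> b n \<noteq> a i"
      unfolding eventually_sequentially by (metis atMost_iff)
    then show ?thesis by (intro exI[of _ "max M (Suc N)"]) auto
  qed
  then obtain g where g: "\<And>N. g N > N"
      "\<And>N i n. i \<le> N \<Longrightarrow> n \<ge> g N \<Longrightarrow> a n \<noteq> b i \<and> b n \<noteq> a i"
    by metis
  \<comment> \<open>\<open>g N\<close> is past every coincidence with an index up to \<open>N\<close>, so iterating \<open>g\<close> avoids
    coincidences with all earlier terms, not only with the previous one.\<close>
  define r where "r k = (g ^^ k) 0" for k
  have r_Suc: "r (Suc k) = g (r k)" for k by (simp add: r_def)
  have r: "strict_mono r" by (simp add: strict_mono_Suc_iff r_Suc g(1))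
  have apart: "a (r j) \<noteq> b (r i) \<and> b (r j) \<noteq> a (r i)" if "i < j" for i j
  proof -
    obtain k where "j = Suc k" "i \<le> k" using \<open>i < j\<close> by (cases j) auto
    then show ?thesis
      using g(2)[of "r i" "r k" "r j"] r by (simp add: r_Suc strict_mono_less_eq)
  qed
  have "a (r m) \<noteq> b (r n)" for m n
    using apart[of m n] apart[of n m] neq[of "r m"] by (cases m n rule: linorder_cases) metis+
  with r show ?thesis by blast
qed

text \<open>Nearest points need not exist, so the isolation is not attained in general. Instead, a
  companion \<open>b k\<close> at distance below \<open>1 / (k + 1)\<close> is chosen at an index \<open>s k \<ge> k\<close> where the
  isolation is below that bound; coincidences are then removed by thinning out.\<close>

lemma not_UC_set_obtain_pairs:
  fixes A :: "'a::metric_space set"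
  assumes "\<not> UC_set A"
  obtains a b where "range a \<subseteq> A" "\<nexists>x. seq_cluster_point a x"
    "(\<lambda>n. dist (a n) (b n)) \<longlonglongrightarrow> 0" "\<And>m n. a m \<noteq> b n"
proof -
  obtain a where aA: "range a \<subseteq> A" and lim: "(\<lambda>n. isolation (a n)) \<longlonglongrightarrow> 0"
    and no_cluster: "\<nexists>x. seq_cluster_point a x"
    using assms unfolding UC_set_def by blast
  have "\<exists>n\<ge>k. \<exists>y. y \<noteq> a n \<and> dist (a n) y < inverse (real (Suc k))" for k
  proof -
    have "\<forall>\<^sub>F n in sequentially. isolation (a n) < ereal (inverse (real (Suc k)))"
      using lim by (rule order_tendstoD) simp
    then show ?thesis
      unfolding isolation_less_iff eventually_sequentially by (meson nle_le)
  qed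
  then obtain s b where s: "\<And>k. s k \<ge> k" and neq: "\<And>k. b k \<noteq> a (s k)"
    and close: "\<And>k. dist (a (s k)) (b k) < inverse (real (Suc k))"
    by metis
  have no_cluster': "\<nexists>x. seq_cluster_point (\<lambda>k. a (s k)) x"
    using no_cluster
    by (rule not_cluster_reindex) (use s in \<open>auto intro: filterlim_at_top_mono[OF filterlim_ident]\<close>)
  have lim': "(\<lambda>k. dist (a (s k)) (b k)) \<longlonglongrightarrow> 0"
    using close by (rule dist_tendsto_0_if_less_inverse)
  obtain r :: "nat \<Rightarrow> nat" where r: "strict_mono r" and disjoint: "\<And>m n. a (s (r m)) \<noteq> b (r n)"
    using ex_subseq_disjoint[OF no_cluster' lim' neq] by blast
  show thesis
  proof
    show "range (\<lambda>n. a (s (r n))) \<subseteq> A" using aA by auto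
    show "\<nexists>x. seq_cluster_point (\<lambda>n. a (s (r n))) x"
      using not_cluster_reindex[OF no_cluster' filterlim_subseq[OF r]] .
    show "(\<lambda>n. dist (a (s (r n))) (b (r n))) \<longlonglongrightarrow> 0"
      using filterlim_compose[OF lim' filterlim_subseq[OF r]] .
    show "a (s (r m)) \<noteq> b (r n)" for m n by (rule disjoint)
  qed
qed

section \<open>The characterization of UC sets by reciprocals\<close>

theorem theorem13:
  fixes A :: "'a::metric_space set"
  assumes "A \<noteq> {}"
  shows "UC_set A \<longleftrightarrow>
    (\<forall>f :: 'a \<Rightarrow> real.
       continuous_on UNIV f \<and> (\<forall>x. f x \<noteq> 0) \<and> strongly_uniformly_continuous_on A f
       \<longrightarrow> strongly_uniformly_continuous_on A (\<lambda>x. 1 / f x))"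
proof (intro iffI allI impI; (elim conjE)?)
  fix f :: "'a \<Rightarrow> real"
  assume "UC_set A" "continuous_on UNIV f" "\<forall>x. f x \<noteq> 0"
  then show "strongly_uniformly_continuous_on A (\<lambda>x. 1 / f x)"
    by (intro UC_set_imp_strongly_uniformly_continuous_on continuous_intros) auto
next
  assume reciprocal: "\<forall>f :: 'a \<Rightarrow> real.
       continuous_on UNIV f \<and> (\<forall>x. f x \<noteq> 0) \<and> strongly_uniformly_continuous_on A f
       \<longrightarrow> strongly_uniformly_continuous_on A (\<lambda>x. 1 / f x)"
  show "UC_set A"
  proof (rule ccontr)
    assume "\<not> UC_set A"
    then obtain a b where aA: "range a \<subseteq> A" and no_cluster: "\<nexists>x. seq_cluster_point a x"
      and lim: "(\<lambda>n. dist (a n) (b n)) \<longlonglongrightarrow> 0" and disjoint: "\<And>m n. a m \<noteq> b n"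
      by (rule not_UC_set_obtain_pairs) blast
    obtain f :: "'a \<Rightarrow> real" where lip: "1-lipschitz_on UNIV f" and pos: "\<And>x. f x > 0"
      and gap: "\<And>n. 1 / f (b n) + 1 \<le> 1 / f (a n)"
      using ex_lipschitz_reciprocal_gap[of a b, OF no_cluster disjoint] by blast
    have "uniformly_continuous_on UNIV f"
      using lip by (rule lipschitz_on_uniformly_continuous)
    then have "continuous_on UNIV f" "strongly_uniformly_continuous_on A f"
      by (auto intro: uniformly_continuous_imp_continuous
          uniformly_continuous_imp_strongly_uniformly_continuous_on)
    moreover have "f x \<noteq> 0" for x using pos[of x] by simp
    ultimately have "strongly_uniformly_continuous_on A (\<lambda>x. 1 / f x)"
      using reciprocal by blast
    then have "(\<lambda>n. dist (1 / f (a n)) (1 / f (b n))) \<longlonglongrightarrow> 0"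
      using aA lim by (rule strongly_uniformly_continuous_on_tendsto)
    then have "\<forall>\<^sub>F n in sequentially. dist (1 / f (a n)) (1 / f (b n)) < 1"
      by (rule order_tendstoD) simp
    then obtain n where "dist (1 / f (a n)) (1 / f (b n)) < 1"
      using eventually_happens by force
    then show False using gap[of n] by (simp add: dist_real_def)
  qed
qed

end
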